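(* Let $\mathbb{E}$ be an embedding of the graph $G$ and let $v$ be a vertex of $G$. Assume $v$ is incident to $q$ faces of $\mathbb{E}$, let $(s_v,\pi_v)_q$ be the $q$-cyc plane permutation of $v$ and let $D_v=s_v\circ\pi_v^{-1}$ be its diagonal. For an integer $\Delta g$, let $R_v(\Delta g)$ denote the number of different ways to arrange the half edges around $v$ (i.e. the number of cyclic orders on $H(v)$) such that the obtained embedding $\mathbb{E}'$ has genus $g(\mathbb{E}')=g(\mathbb{E})+\Delta g$. Then $$R_v(\Delta g)=p^{\lambda(D_v)}_{q-2\Delta g}(deg(v)),$$ where $\lambda(D_v)$ is the cycle-type of $D_v$.
   Context: Graphs are finite and connected with at least one edge, loops and multiple edges allowed. An embedding is a 2-cell embedding on a closed orientable surface. Permutations are composed right to left, and fixed points count as cycles. An embedding $\mathbb{E}$ of $G$ with $e$ edges is encoded by a triple $(\alpha,\beta,\gamma)$ of permutations of the set $[2e]$ of half edges (each edge consists of two half edges): $\alpha$ is the fixed-point-free involution pairing the two half edges of each edge; the cycles of $\beta$ are the vertices, each cycle listing the half edges incident to that vertex in counterclockwise cyclic order; $\gamma=\alpha\beta$, and its cycles are the faces. Write $s=\gamma$, $\pi=\beta$, so $\alpha=s\circ\pi^{-1}$. The genus $g=g(\mathbb{E})$ is given by $(\#\text{vertices})-(\#\text{edges})+(\#\text{faces})=2-2g$. For a vertex $v$, $H(v)$ is the set of half edges incident to $v$ and $deg(v)=|H(v)|$. A face is incident to $v$ if the corresponding cycle of $s$ contains an element of $H(v)$. Rearranging the half edges around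 $v$ according to a cyclic order (a $deg(v)$-cycle) $\theta$ on $H(v)$ means replacing the cycle of $\beta$ on $H(v)$ by $\theta$, keeping $\alpha$ and all other cycles of $\beta$; the new faces are the cycles of $\alpha\beta'$, with $\beta'$ the modified permutation. If $v$ is incident to $q$ faces, then $(s_v,\pi_v)_q$ is the pair of permutations of $H(v)$ in which $s_v$ (with $q$ cycles) is obtained from the $q$ cycles of $s$ incident to $v$ by deleting all elements not in $H(v)$, and $\pi_v$ is the restriction of $\pi$ to $H(v)$ (a single cycle). For a partition $\lambda$ of $n$, $p_k^{\lambda}(n)$ denotes the number of pairs $(s',\pi')$ of permutations of an $n$-element set such that $s'$ is an $n$-cycle, $\pi'$ has exactly $k$ cycles, and $s'\circ\pi'^{-1}=D$, where $D$ is any fixed permutation of cycle-type $\lambda$ (the number depends only on $\lambda$; it is $0$ if no such pairs exist). *)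

theory Defs
  imports "HOL-Combinatorics.Orbits" "HOL-Library.Disjoint_Sets" "HOL-Library.Multiset"
    Complex_Main
begin

text \<open>A cycle is recorded by its underlying set; fixed points in \<open>S\<close> give singleton cycles.\<close>

definition cycles_on :: "('a \<Rightarrow> 'a) \<Rightarrow> 'a set \<Rightarrow> 'a set set" where
  "cycles_on f S = orbit f ` S"

definition cycle_type :: "('a \<Rightarrow> 'a) \<Rightarrow> 'a set \<Rightarrow> nat multiset" where
  "cycle_type f S = image_mset card (mset_set (cycles_on f S))"

text \<open>
  Deleting from the cycles of \<open>f\<close> all elements outside \<open>S\<close>: each element of \<open>S\<close> is sent to the
  next element of \<open>S\<close> that follows it on its \<open>f\<close>-cycle.
\<close>

definition induced_perm :: "('a \<Rightarrow> 'a) \<Rightarrow> 'a set \<Rightarrow> 'a \<Rightarrow> 'a" where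
  "induced_perm f S x =
     (if x \<in> S then (f ^^ (LEAST n. 0 < n \<and> (f ^^ n) x \<in> S)) x else x)"

text \<open>
  A finite graph, with loops and multiple edges allowed, is given by its set \<open>H\<close> of half edges,
  the involution \<open>\<alpha>\<close> pairing the two halves of each edge, and the partition \<open>V\<close> of \<open>H\<close> into the
  sets of half edges incident to a common vertex. A vertex \<open>v\<close> is identified with its set of
  incident half edges, so that its degree is \<open>card v\<close>; no vertex is lost by this, as a connected
  graph with at least one edge has no isolated vertices.
\<close>

definition connected_graph :: "'a set \<Rightarrow> ('a \<Rightarrow> 'a) \<Rightarrow> 'a set set \<Rightarrow> bool" where
  "connected_graph H \<alpha> V \<longleftrightarrow>
     finite H \<and> H \<noteq> {} \<and>
     \<alpha> permutes H \<and> (\<forall>x\<in>H. \<alpha> (\<alpha> x) = x \<and> \<alpha> x \<noteq> x) \<and>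
     partition_on H V \<and>
     (\<forall>u\<in>V. \<forall>w\<in>V. (u, w) \<in> {(a, b). a \<in> V \<and> b \<in> V \<and> (\<exists>x\<in>a. \<alpha> x \<in> b)}\<^sup>*)"

text \<open>
  A 2-cell embedding of the graph on a closed orientable surface, encoded by the counterclockwise
  rotation \<open>\<beta>\<close> of the half edges around the vertices. The third permutation of the usual triple
  is determined by \<open>\<alpha>\<close> and \<open>\<beta>\<close>.
\<close>

definition embedding_of :: "'a set \<Rightarrow> ('a \<Rightarrow> 'a) \<Rightarrow> 'a set set \<Rightarrow> ('a \<Rightarrow> 'a) \<Rightarrow> bool" where
  "embedding_of H \<alpha> V \<beta> \<longleftrightarrow> connected_graph H \<alpha> V \<and> \<beta> permutes H \<and> cycles_on \<beta> H = V"

definition face_perm :: "('a \<Rightarrow> 'a) \<Rightarrow> ('a \<Rightarrow> 'a) \<Rightarrow> 'a \<Rightarrow> 'a" where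
  "face_perm \<alpha> \<beta> = \<alpha> \<circ> \<beta>"

text \<open>
  The solution \<open>g\<close> of \<open>#vertices - #edges + #faces = 2 - 2 g\<close>. It is taken in the rationals so
  that the equation can be solved without rounding.
\<close>

definition genus :: "'a set \<Rightarrow> ('a \<Rightarrow> 'a) \<Rightarrow> ('a \<Rightarrow> 'a) \<Rightarrow> rat" where
  "genus H \<alpha> \<beta> =
     (2 - (of_nat (card (cycles_on \<beta> H)) - of_nat (card (cycles_on \<alpha> H))
           + of_nat (card (cycles_on (face_perm \<alpha> \<beta>) H)))) / 2"

definition incident_faces :: "'a set \<Rightarrow> ('a \<Rightarrow> 'a) \<Rightarrow> ('a \<Rightarrow> 'a) \<Rightarrow> 'a set \<Rightarrow> 'a set set" where
  "incident_faces H \<alpha> \<beta> v = {F \<in> cycles_on (face_perm \<alpha> \<beta>) H. F \<inter> v \<noteq> {}}"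

definition cyclic_orders :: "'a set \<Rightarrow> ('a \<Rightarrow> 'a) set" where
  "cyclic_orders v = {\<theta>. \<theta> permutes v \<and> cyclic_on \<theta> v}"

definition rearrange :: "('a \<Rightarrow> 'a) \<Rightarrow> 'a set \<Rightarrow> ('a \<Rightarrow> 'a) \<Rightarrow> 'a \<Rightarrow> 'a" where
  "rearrange \<beta> v \<theta> = override_on \<beta> \<theta> v"

definition rearrangement_count ::
    "'a set \<Rightarrow> ('a \<Rightarrow> 'a) \<Rightarrow> ('a \<Rightarrow> 'a) \<Rightarrow> 'a set \<Rightarrow> int \<Rightarrow> nat" where
  "rearrangement_count H \<alpha> \<beta> v \<Delta>g =
     card {\<theta> \<in> cyclic_orders v.
             genus H \<alpha> (rearrange \<beta> v \<theta>) = genus H \<alpha> \<beta> + of_int \<Delta>g}"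

definition local_s :: "('a \<Rightarrow> 'a) \<Rightarrow> ('a \<Rightarrow> 'a) \<Rightarrow> 'a set \<Rightarrow> 'a \<Rightarrow> 'a" where
  "local_s \<alpha> \<beta> v = induced_perm (face_perm \<alpha> \<beta>) v"

definition local_pi :: "('a \<Rightarrow> 'a) \<Rightarrow> 'a set \<Rightarrow> 'a \<Rightarrow> 'a" where
  "local_pi \<beta> v = perm_restrict \<beta> v"

definition diagonal :: "('a \<Rightarrow> 'a) \<Rightarrow> ('a \<Rightarrow> 'a) \<Rightarrow> 'a set \<Rightarrow> 'a \<Rightarrow> 'a" where
  "diagonal \<alpha> \<beta> v = local_s \<alpha> \<beta> v \<circ> inv (local_pi \<beta> v)"

definition plane_perms_with_diagonal ::
    "'b set \<Rightarrow> int \<Rightarrow> ('b \<Rightarrow> 'b) \<Rightarrow> (('b \<Rightarrow> 'b) \<times> ('b \<Rightarrow> 'b)) set" where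
  "plane_perms_with_diagonal S k D =
     {(s, \<pi>). s permutes S \<and> cyclic_on s S \<and>
              \<pi> permutes S \<and> int (card (cycles_on \<pi> S)) = k \<and>
              s \<circ> inv \<pi> = D}"

text \<open>
  The number of such pairs for a partition \<open>lam\<close> of \<open>n\<close>. The diagonal is an arbitrary permutation of
  cycle type \<open>lam\<close>, on whose choice the number does not depend. The index \<open>k\<close> is an integer, and
  the number is 0 for \<open>k \<le> 0\<close>.
\<close>

definition p_num :: "nat multiset \<Rightarrow> int \<Rightarrow> nat \<Rightarrow> nat" where
  "p_num lam k n =
     card (plane_perms_with_diagonal {1..n} k
             (SOME D. D permutes {1..n} \<and> cycle_type D {1..n} = lam))"

end

theory Submission
  imports Defs
begin

text \<open>
  Let \<open>\<pi>\<close> be the cycle of \<open>\<beta>\<close> on \<open>v\<close>. Replacing \<open>\<pi>\<close> by \<open>\<theta>\<close> amounts to composing on the right with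
  \<open>\<tau> = \<pi>\<^sup>-\<^sup>1 \<theta>\<close>: both \<open>\<beta>\<close> and the face permutation \<open>\<gamma> = \<alpha> \<beta>\<close> become \<open>\<beta> \<tau>\<close> and \<open>\<gamma> \<tau>\<close>. The correction \<open>\<tau>\<close>
  lives on \<open>v\<close>, so it has two simple effects on the cycles of any permutation \<open>f\<close>. Cycles that
  avoid \<open>v\<close> remain, and the cycles that meet \<open>v\<close> correspond to the cycles of the induced permutation
  of \<open>v\<close>, which changes from \<open>f\<^sub>v\<close> to \<open>f\<^sub>v \<tau>\<close> because a path of \<open>f \<tau>\<close> that has left \<open>v\<close> follows \<open>f\<close>
  until it returns. Hence the change in the number of cycles can be read off inside \<open>v\<close>
  (\<open>card_cycles_comp\<close>).

  For \<open>f = \<beta>\<close> the induced permutation goes from the single cycle \<open>\<pi>\<close> to the single cycle \<open>\<theta>\<close>, so the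
  number of vertices is unchanged. For \<open>f = \<gamma>\<close> it goes from \<open>s\<^sub>v\<close>, with \<open>q\<close> cycles, to
  \<open>s\<^sub>v \<pi>\<^sup>-\<^sup>1 \<theta> = D\<^sub>v \<theta>\<close>. By Euler's formula the genus grows by \<open>\<Delta>g\<close> iff \<open>D\<^sub>v \<theta>\<close> has \<open>q - 2 \<Delta>g\<close> cycles.

  It remains to count the cyclic orders \<open>\<theta>\<close> with that property. The pair
  \<open>(\<theta>\<^sup>-\<^sup>1, D\<^sub>v\<^sup>-\<^sup>1 \<theta>\<^sup>-\<^sup>1)\<close> has diagonal \<open>D\<^sub>v\<close>, and its second component is the inverse of \<open>\<theta> D\<^sub>v\<close>, a
  conjugate of \<open>D\<^sub>v \<theta>\<close>; so the \<open>\<theta>\<close> correspond to the pairs of permutations of \<open>v\<close> that \<open>p\<close>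
  counts (\<open>card_cyclic_orders_with_product\<close>). Permutations with the same cycle type are conjugate, even
  across different sets (\<open>conjugate_if_cycle_type_eq\<close>), which moves the count from \<open>v\<close> to
  \<open>{1..deg v}\<close> and makes it independent of the chosen diagonal (\<open>p_num_eq\<close>).
\<close>

section \<open>Cycles of permutations of finite sets\<close>

lemma self_in_orbit_permutes:
  assumes "f permutes S" "finite S"
  shows "x \<in> orbit f x"
  using permutation_self_in_orbit[OF permutes_imp_permutation[OF assms(2,1)]] .

lemma orbit_eq_of_mem:
  assumes "f permutes S" "finite S" "y \<in> orbit f x"
  shows "orbit f y = orbit f x"
  by (rule orbit_cyclic_eq3[OF cyclic_on_orbit[OF assms(1,2)] assms(3)])

lemma finite_cycles_on [simp]: "finite S \<Longrightarrow> finite (cycles_on f S)"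
  by (simp add: cycles_on_def)

lemma disjoint_cycles_on:
  assumes "f permutes S" "finite S" "C \<in> cycles_on f S" "C' \<in> cycles_on f S" "x \<in> C" "x \<in> C'"
  shows "C = C'"
  using assms(3-6) orbit_eq_of_mem[OF assms(1,2)] unfolding cycles_on_def by (metis imageE)

lemma cycles_on_cyclic:
  assumes "cyclic_on f S"
  shows "cycles_on f S = {S}"
  using assms by (auto simp: cycles_on_def cyclic_on_alldef)

lemma cycles_on_inv:
  assumes "f permutes S" "finite S"
  shows "cycles_on (inv f) S = cycles_on f S"
  using orbit_inv_eq[OF permutes_imp_permutation[OF assms(2,1)]] by (simp add: cycles_on_def)

lemma cyclic_on_inv_iff:
  assumes "f permutes S" "finite S"
  shows "cyclic_on (inv f) S \<longleftrightarrow> cyclic_on f S"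
  using orbit_inv_eq[OF permutes_imp_permutation[OF assms(2,1)]] by (simp add: cyclic_on_def)

section \<open>Conjugation\<close>

lemma cycles_on_conjugate:
  assumes "f permutes S" "finite S" "bij_betw \<phi> S T" "\<And>x. x \<in> S \<Longrightarrow> g (\<phi> x) = \<phi> (f x)"
  shows "cycles_on g T = (`) \<phi> ` cycles_on f S"
proof -
  have "orbit g (\<phi> x) = \<phi> ` orbit f x" if "x \<in> S" for x
  proof (rule orbit_inverse[symmetric])
    show "x \<in> orbit f x" using assms(1,2) by (rule self_in_orbit_permutes)
    show "g (\<phi> y) = \<phi> (f y)" if "y \<in> orbit f x" for y
      using permutes_orbit_subset[OF assms(1) \<open>x \<in> S\<close>] that assms(4) by auto
  qed
  moreover have "T = \<phi> ` S" using assms(3) by (simp add: bij_betw_def)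
  ultimately show ?thesis by (auto simp: cycles_on_def)
qed

lemma inj_on_image_cycles_on:
  assumes "f permutes S" "bij_betw \<phi> S T"
  shows "inj_on ((`) \<phi>) (cycles_on f S)"
proof (rule inj_on_subset)
  show "inj_on ((`) \<phi>) (Pow S)" using assms(2) by (simp add: bij_betw_def inj_on_image_Pow)
  show "cycles_on f S \<subseteq> Pow S"
    using permutes_orbit_subset[OF assms(1)] by (auto simp: cycles_on_def)
qed

lemma card_cycles_on_conjugate:
  assumes "f permutes S" "finite S" "bij_betw \<phi> S T" "\<And>x. x \<in> S \<Longrightarrow> g (\<phi> x) = \<phi> (f x)"
  shows "card (cycles_on g T) = card (cycles_on f S)"
  using cycles_on_conjugate[OF assms] card_image[OF inj_on_image_cycles_on[OF assms(1,3)]] by simp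

lemma cycle_type_conjugate:
  assumes "f permutes S" "finite S" "bij_betw \<phi> S T" "\<And>x. x \<in> S \<Longrightarrow> g (\<phi> x) = \<phi> (f x)"
  shows "cycle_type g T = cycle_type f S"
proof -
  have "inj_on \<phi> C" if "C \<in> cycles_on f S" for C
    using that assms(3) permutes_orbit_subset[OF assms(1)]
    by (auto simp: cycles_on_def bij_betw_def intro: inj_on_subset)
  hence "image_mset (card \<circ> (`) \<phi>) (mset_set (cycles_on f S))
           = image_mset card (mset_set (cycles_on f S))"
    using assms(2) by (intro image_mset_cong) (simp add: card_image)
  moreover have "mset_set (cycles_on g T) = image_mset ((`) \<phi>) (mset_set (cycles_on f S))"
    using cycles_on_conjugate[OF assms]
      image_mset_mset_set[OF inj_on_image_cycles_on[OF assms(1,3)]] by simp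
  ultimately show ?thesis by (simp add: cycle_type_def multiset.map_comp)
qed

text \<open>
  On a cycle, exponents matter modulo its length only. This lets a map between two cycles of equal
  length be defined through exponents.
\<close>

lemma funpow_eq_iff_mod_card_orbit:
  assumes "x \<in> orbit f x"
  shows "(f ^^ m) x = (f ^^ n) x \<longleftrightarrow> m mod card (orbit f x) = n mod card (orbit f x)"
proof -
  let ?d = "funpow_dist1 f x x"
  have inj: "inj_on (\<lambda>n. (f ^^ n) x) {0..<?d}"
    by (rule inj_on_funpow_dist1[OF assms])
  have d: "card (orbit f x) = ?d"
    using orbit_conv_funpow_dist1[OF assms] card_image[OF inj] by simp
  have "(f ^^ n) x = (f ^^ (n mod ?d)) x" for n
    using funpow_mod_eq[OF funpow_dist1_prop[OF assms]] by metis
  moreover have "(f ^^ (m mod ?d)) x = (f ^^ (n mod ?d)) x \<longleftrightarrow> m mod ?d = n mod ?d"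
    using inj_on_eq_iff[OF inj, of "m mod ?d" "n mod ?d"] by simp
  ultimately show ?thesis unfolding d by metis
qed

lemma orbits_conjugate:
  assumes x: "x \<in> orbit f x" and y: "y \<in> orbit g y"
    and card: "card (orbit f x) = card (orbit g y)"
  obtains h where "bij_betw h (orbit f x) (orbit g y)"
    and "\<And>z. z \<in> orbit f x \<Longrightarrow> g (h z) = h (f z)"
proof -
  \<comment> \<open>\<open>h\<close> sends the point \<open>n\<close> steps after \<open>x\<close> to the point \<open>n\<close> steps after \<open>y\<close>.\<close>
  define h where "h = (\<lambda>z. (g ^^ (funpow_dist f x z)) y)"
  have h: "h ((f ^^ n) x) = (g ^^ n) y" for n
  proof -
    have "(f ^^ n) x \<in> orbit f x" using x by (rule funpow_in_orbit)
    hence "(f ^^ funpow_dist f x ((f ^^ n) x)) x = (f ^^ n) x" by (rule funpow_dist_prop)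
    thus ?thesis
      unfolding h_def funpow_eq_iff_mod_card_orbit[OF x] funpow_eq_iff_mod_card_orbit[OF y] card .
  qed
  have "h ` orbit f x = orbit g y"
    by (auto simp: orbit_altdef_self_in[OF x] orbit_altdef_self_in[OF y] h image_iff) (metis h)
  hence "bij_betw h (orbit f x) (orbit g y)"
    using card finite_orbit[OF x] by (simp add: bij_betw_def eq_card_imp_inj_on)
  moreover have "g (h z) = h (f z)" if "z \<in> orbit f x" for z
  proof -
    obtain n where n: "z = (f ^^ n) x" using \<open>z \<in> orbit f x\<close> by (auto simp: orbit_altdef)
    show ?thesis using h[of n] h[of "Suc n"] by (simp add: n)
  qed
  ultimately show ?thesis by (rule that)
qed

text \<open>
  Elements of \<open>A\<close> and \<open>B\<close> are matched one at a time by their labels. With cycles as elements and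
  lengths as labels, this pairs the cycles of two permutations of equal cycle type.
\<close>

lemma bij_betw_of_image_mset_eq:
  assumes "finite A" "finite B" "image_mset f (mset_set A) = image_mset g (mset_set B)"
  shows "\<exists>h. bij_betw h A B \<and> (\<forall>a\<in>A. g (h a) = f a)"
  using assms
proof (induction A arbitrary: B rule: finite_induct)
  case empty
  hence "B = {}" by (simp add: mset_set_empty_iff)
  thus ?case by (simp add: bij_betw_def)
next
  case (insert a A)
  have "f a \<in># image_mset g (mset_set B)"
    using insert by (simp flip: insert.prems(2))
  then obtain b where b: "b \<in> B" "g b = f a" using insert.prems by auto
  have "mset_set B = add_mset b (mset_set (B - {b}))"
    using b insert.prems(1) by (simp add: mset_set.remove)
  hence "image_mset f (mset_set A) = image_mset g (mset_set (B - {b}))"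
    using insert b by simp
  then obtain h where h: "bij_betw h A (B - {b})" "\<forall>a\<in>A. g (h a) = f a"
    using insert.IH[of "B - {b}"] insert.prems by auto
  have "bij_betw (h(a := b)) A (B - {b})"
    using h(1) insert.hyps by (subst bij_betw_cong[of _ _ h]) auto
  hence "bij_betw (h(a := b)) (insert a A) (insert b (B - {b}))"
    using insert.hyps by (auto simp: bij_betw_def)
  hence "bij_betw (h(a := b)) (insert a A) B" using b by (simp add: insert_absorb)
  moreover have "\<forall>x\<in>insert a A. g ((h(a := b)) x) = f x" using h(2) b(2) insert.hyps by auto
  ultimately show ?case by blast
qed

text \<open>
  Cycles are paired by length, each pair is identified by rotating along the cycles, and the
  resulting bijections between disjoint cycles are glued.
\<close>

lemma conjugate_if_cycle_type_eq:
  assumes f: "f permutes S" "finite S" and g: "g permutes T" "finite T"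
    and type: "cycle_type f S = cycle_type g T"
  obtains \<phi> where "bij_betw \<phi> S T" and "\<And>x. x \<in> S \<Longrightarrow> g (\<phi> x) = \<phi> (f x)"
proof -
  obtain \<Phi> where \<Phi>: "bij_betw \<Phi> (cycles_on f S) (cycles_on g T)"
    "\<And>C. C \<in> cycles_on f S \<Longrightarrow> card (\<Phi> C) = card C"
    using bij_betw_of_image_mset_eq[of "cycles_on f S" "cycles_on g T" card card] type f(2) g(2)
    by (auto simp: cycle_type_def)
  have "\<exists>h. bij_betw h C (\<Phi> C) \<and> (\<forall>z\<in>C. g (h z) = h (f z))" if C: "C \<in> cycles_on f S" for C
  proof -
    obtain x where x: "C = orbit f x" using C by (auto simp: cycles_on_def)
    have "\<Phi> C \<in> cycles_on g T" using \<Phi>(1) C by (auto simp: bij_betw_def)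
    then obtain y where y: "\<Phi> C = orbit g y" by (auto simp: cycles_on_def)
    have "card (orbit f x) = card (orbit g y)" using \<Phi>(2)[OF C] x y by simp
    with self_in_orbit_permutes[OF f] self_in_orbit_permutes[OF g] show ?thesis
      unfolding x(1) y[unfolded x(1)] by (rule orbits_conjugate) blast
  qed
  then obtain h where h: "\<And>C. C \<in> cycles_on f S \<Longrightarrow> bij_betw (h C) C (\<Phi> C)"
    "\<And>C z. C \<in> cycles_on f S \<Longrightarrow> z \<in> C \<Longrightarrow> g (h C z) = h C (f z)"
    by metis
  define \<phi> where "\<phi> = (\<lambda>x. h (orbit f x) x)"
  have mem: "orbit f x \<in> cycles_on f S" "x \<in> orbit f x" if "x \<in> S" for x
    using that self_in_orbit_permutes[OF f] by (auto simp: cycles_on_def)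
  have \<phi>_mem: "\<phi> x \<in> \<Phi> (orbit f x)" if "x \<in> S" for x
    using h(1)[OF mem(1)[OF that]] mem(2)[OF that] by (auto simp: \<phi>_def bij_betw_def)
  have in_cyc: "\<Phi> (orbit f x) \<in> cycles_on g T" if "x \<in> S" for x
    using \<Phi>(1) mem(1)[OF that] by (auto simp: bij_betw_def)
  have "bij_betw \<phi> S T"
    unfolding bij_betw_def
  proof
    show "inj_on \<phi> S"
    proof (rule inj_onI)
      fix x y assume xy: "x \<in> S" "y \<in> S" "\<phi> x = \<phi> y"
      have "\<Phi> (orbit f x) = \<Phi> (orbit f y)"
        using disjoint_cycles_on[OF g in_cyc[OF xy(1)] in_cyc[OF xy(2)]] \<phi>_mem[OF xy(1)]
          \<phi>_mem[OF xy(2)] xy(3) by metis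
      hence "orbit f x = orbit f y"
        using \<Phi>(1) mem(1) xy by (auto simp: bij_betw_def dest: inj_onD)
      thus "x = y"
        using h(1)[OF mem(1)[OF xy(1)]] xy mem(2)
        by (auto simp: \<phi>_def bij_betw_def dest: inj_onD)
    qed
    show "\<phi> ` S = T"
    proof (intro equalityI subsetI)
      fix y assume "y \<in> \<phi> ` S"
      then obtain x where x: "x \<in> S" "y = \<phi> x" by auto
      obtain t where "t \<in> T" "\<Phi> (orbit f x) = orbit g t"
        using in_cyc[OF x(1)] by (auto simp: cycles_on_def)
      thus "y \<in> T" using \<phi>_mem[OF x(1)] x(2) permutes_orbit_subset[OF g(1)] by auto
    next
      fix y assume "y \<in> T"
      hence "orbit g y \<in> \<Phi> ` cycles_on f S" using \<Phi>(1) by (auto simp: bij_betw_def cycles_on_def)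
      then obtain C where C: "C \<in> cycles_on f S" "\<Phi> C = orbit g y" by auto
      have "y \<in> \<Phi> C" using C(2) self_in_orbit_permutes[OF g] by simp
      then obtain x where x: "x \<in> C" "h C x = y" using h(1)[OF C(1)] by (metis bij_betw_imp_surj_on imageE)
      have "x \<in> S" using x C permutes_orbit_subset[OF f(1)] by (auto simp: cycles_on_def)
      moreover from this have "orbit f x = C"
        using disjoint_cycles_on[OF f mem(1) C(1) mem(2) x(1)] by blast
      ultimately show "y \<in> \<phi> ` S" using x(2) by (force simp: \<phi>_def)
    qed
  qed
  moreover have "g (\<phi> x) = \<phi> (f x)" if "x \<in> S" for x
    using h(2)[OF mem[OF that]] self_in_orbit_step[OF mem(2)[OF that]] by (simp add: \<phi>_def)
  ultimately show ?thesis by (rule that)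
qed

section \<open>Counting plane permutations with a given diagonal\<close>

lemma finite_plane_perms_with_diagonal:
  assumes "finite S"
  shows "finite (plane_perms_with_diagonal S k D)"
  by (rule finite_subset[of _ "{s. s permutes S} \<times> {\<pi>. \<pi> permutes S}"])
    (auto simp: plane_perms_with_diagonal_def finite_permutations assms)

lemma map_permutation_inj_on:
  assumes "inj_on \<phi> S"
  shows "inj_on (map_permutation S \<phi>) {p. p permutes S}"
  using map_permutation_compose_inv[where f = \<phi> and A = S and B = "\<phi> ` S" and g = "inv_into S \<phi>"] assms
  by (intro inj_on_inverseI[where g = "map_permutation (\<phi> ` S) (inv_into S \<phi>)"])
    (auto simp: bij_betw_def)

lemma map_permutation_conjugate:
  assumes "inj_on \<phi> S" "p permutes S" "q permutes \<phi> ` S" "\<And>x. x \<in> S \<Longrightarrow> q (\<phi> x) = \<phi> (p x)"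
  shows "map_permutation S \<phi> p = q"
proof
  fix y show "map_permutation S \<phi> p y = q y"
  proof (cases "y \<in> \<phi> ` S")
    case True
    then obtain x where "x \<in> S" "y = \<phi> x" by auto
    thus ?thesis using assms by (simp add: map_permutation_apply)
  next
    case False
    thus ?thesis using assms(3) by (simp add: map_permutation_def permutes_not_in)
  qed
qed

text \<open>
  Relabelling along \<open>\<phi>\<close> preserves composition and cycle structure, so it maps pairs with diagonal
  \<open>D\<close> injectively to pairs with the conjugate diagonal. An inequality is enough, since conjugacy
  is symmetric.
\<close>

lemma card_plane_perms_with_diagonal_le:
  assumes D: "D permutes S" "finite S" and D': "D' permutes T"
    and \<phi>: "bij_betw \<phi> S T" "\<And>x. x \<in> S \<Longrightarrow> D' (\<phi> x) = \<phi> (D x)"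
  shows "card (plane_perms_with_diagonal S k D) \<le> card (plane_perms_with_diagonal T k D')"
proof -
  let ?m = "map_permutation S \<phi>"
  have inj: "inj_on \<phi> S" and T: "T = \<phi> ` S" using \<phi>(1) by (auto simp: bij_betw_def)
  have conj: "?m p (\<phi> x) = \<phi> (p x)" if "x \<in> S" for p x
    using inj that by (rule map_permutation_apply)
  show ?thesis
  proof (rule card_inj_on_le[where f = "map_prod ?m ?m"])
    show "inj_on (map_prod ?m ?m) (plane_perms_with_diagonal S k D)"
      by (rule inj_on_subset[OF map_prod_inj_on[OF map_permutation_inj_on[OF inj]
            map_permutation_inj_on[OF inj]]])
        (auto simp: plane_perms_with_diagonal_def)
    show "finite (plane_perms_with_diagonal T k D')"
      using D(2) T by (intro finite_plane_perms_with_diagonal) simp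
    show "map_prod ?m ?m ` plane_perms_with_diagonal S k D \<subseteq> plane_perms_with_diagonal T k D'"
    proof (rule image_subsetI)
      fix x assume "x \<in> plane_perms_with_diagonal S k D"
      then obtain s \<pi> where x: "x = (s, \<pi>)"
        and s: "s permutes S" "cyclic_on s S" and \<pi>: "\<pi> permutes S" "int (card (cycles_on \<pi> S)) = k"
        and sD: "s \<circ> inv \<pi> = D" by (auto simp: plane_perms_with_diagonal_def)
      have perm: "?m s permutes T" "?m \<pi> permutes T"
        using map_permutation_permutes[OF \<phi>(1)] s \<pi> by auto
      have "s = D \<circ> \<pi>" unfolding sD[symmetric] using \<pi>(1)
        by (simp only: comp_assoc permutes_inv_o comp_id)
      hence "?m s = ?m D \<circ> ?m \<pi>" using map_permutation_compose'[OF inj \<pi>(1)] by simp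
      also have "?m D = D'" using inj D(1) D'[unfolded T] \<phi>(2) by (rule map_permutation_conjugate)
      finally have "?m s \<circ> inv (?m \<pi>) = D'"
        using perm(2) by (simp only: comp_assoc permutes_inv_o comp_id)
      moreover have "cyclic_on (?m s) T"
        unfolding T using s(2) by (rule cyclic_on_image) (rule conj)
      moreover have "card (cycles_on (?m \<pi>) T) = card (cycles_on \<pi> S)"
        using \<pi>(1) D(2) \<phi>(1) conj by (rule card_cycles_on_conjugate)
      ultimately have "(?m s, ?m \<pi>) \<in> plane_perms_with_diagonal T k D'"
        using perm \<pi>(2) by (simp add: plane_perms_with_diagonal_def)
      thus "map_prod ?m ?m x \<in> plane_perms_with_diagonal T k D'" by (simp add: x)
    qed
  qed
qed

lemma card_plane_perms_with_diagonal_cong: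
  assumes D: "D permutes S" "finite S" and D': "D' permutes T" "finite T"
    and type: "cycle_type D S = cycle_type D' T"
  shows "card (plane_perms_with_diagonal S k D) = card (plane_perms_with_diagonal T k D')"
  using conjugate_if_cycle_type_eq[OF D D' type] conjugate_if_cycle_type_eq[OF D' D type[symmetric]]
    card_plane_perms_with_diagonal_le[OF D D'(1)] card_plane_perms_with_diagonal_le[OF D' D(1)]
  by (metis le_antisym)

text \<open>
  The diagonal chosen in \<open>p_num\<close> exists: relabelling \<open>D\<close> by \<open>1, \<dots>, n\<close> gives one of the same cycle
  type.
\<close>

lemma p_num_eq:
  assumes D: "D permutes S" "finite S"
  shows "p_num (cycle_type D S) k (card S) = card (plane_perms_with_diagonal S k D)"
proof -
  let ?P = "\<lambda>D'. D' permutes {1..card S} \<and> cycle_type D' {1..card S} = cycle_type D S"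
  obtain \<phi> where \<phi>: "bij_betw \<phi> S {1..card S}"
    using ex_bij_betw_finite_nat[OF D(2)] bij_betw_iff_card[of S "{1..card S}"] D(2) by auto
  have "?P (map_permutation S \<phi> D)"
    using map_permutation_permutes[OF \<phi> D(1)] cycle_type_conjugate[OF D \<phi>]
      map_permutation_apply[OF bij_betw_imp_inj_on[OF \<phi>]] by metis
  hence "?P (Eps ?P)" by (rule someI[of ?P])
  hence "Eps ?P permutes {1..card S}" "cycle_type (Eps ?P) {1..card S} = cycle_type D S"
    by blast+
  thus ?thesis
    unfolding p_num_def by (intro card_plane_perms_with_diagonal_cong[OF D, symmetric]) auto
qed

text \<open>
  The map \<open>\<theta> \<mapsto> (\<theta>\<^sup>-\<^sup>1, D\<^sup>-\<^sup>1 \<theta>\<^sup>-\<^sup>1)\<close> is the bijection. Inverting \<open>\<theta>\<close> makes the numbers of cycles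
  agree: with \<open>s = \<theta>\<close> the second component would be \<open>D\<^sup>-\<^sup>1 \<theta>\<close>, whose number of cycles differs in
  general from that of \<open>D \<theta>\<close>.
\<close>

lemma card_cyclic_orders_with_product:
  assumes D: "D permutes S" "finite S"
  shows "card {\<theta> \<in> cyclic_orders S. int (card (cycles_on (D \<circ> \<theta>) S)) = k}
           = card (plane_perms_with_diagonal S k D)"
proof (rule bij_betw_same_card)
  \<comment> \<open>\<open>D\<^sup>-\<^sup>1 \<theta>\<^sup>-\<^sup>1\<close> is the inverse of \<open>\<theta> D\<close>, and conjugation by \<open>D\<close> turns \<open>\<theta> D\<close> into \<open>D \<theta>\<close>.\<close>
  have key: "card (cycles_on (inv D \<circ> inv \<theta>) S) = card (cycles_on (D \<circ> \<theta>) S)"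
    if \<theta>: "\<theta> permutes S" for \<theta>
  proof -
    have "inv D \<circ> inv \<theta> = inv (\<theta> \<circ> D)"
      using D(1) \<theta> by (simp add: o_inv_distrib permutes_bij)
    hence "card (cycles_on (inv D \<circ> inv \<theta>) S) = card (cycles_on (\<theta> \<circ> D) S)"
      using D \<theta> by (simp add: cycles_on_inv permutes_compose)
    also have "\<dots> = card (cycles_on (D \<circ> \<theta>) S)"
      using permutes_compose[OF D(1) \<theta>] D(2) permutes_imp_bij[OF D(1)]
      by (intro card_cycles_on_conjugate[symmetric, where \<phi> = D] permutes_compose[OF D(1) \<theta>]) auto
    finally show ?thesis .
  qed
  have pair: "s permutes S \<and> \<pi> = inv D \<circ> s" if "(s, \<pi>) \<in> plane_perms_with_diagonal S k D" for s \<pi>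
  proof -
    have s: "s permutes S" and \<pi>: "\<pi> permutes S" and sD: "s \<circ> inv \<pi> = D"
      using that by (auto simp: plane_perms_with_diagonal_def)
    have "inv D = \<pi> \<circ> inv s"
      using o_inv_distrib[OF permutes_bij[OF s] permutes_bij[OF permutes_inv[OF \<pi>]]] \<pi>
      by (simp add: sD permutes_inv_inv)
    hence "inv D \<circ> s = \<pi>" using s by (simp add: permutes_inv_o flip: o_assoc)
    thus ?thesis using s by simp
  qed
  show "bij_betw (\<lambda>\<theta>. (inv \<theta>, inv D \<circ> inv \<theta>))
          {\<theta> \<in> cyclic_orders S. int (card (cycles_on (D \<circ> \<theta>) S)) = k}
          (plane_perms_with_diagonal S k D)"
  proof (rule bij_betw_byWitness[where f' = "\<lambda>(s, \<pi>). inv s"])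
    show "\<forall>\<theta>\<in>{\<theta> \<in> cyclic_orders S. int (card (cycles_on (D \<circ> \<theta>) S)) = k}.
            (case (inv \<theta>, inv D \<circ> inv \<theta>) of (s, \<pi>) \<Rightarrow> inv s) = \<theta>"
      by (auto simp: cyclic_orders_def permutes_inv_inv)
    show "\<forall>x\<in>plane_perms_with_diagonal S k D.
            (inv (case x of (s, \<pi>) \<Rightarrow> inv s), inv D \<circ> inv (case x of (s, \<pi>) \<Rightarrow> inv s)) = x"
      by (auto dest!: pair simp: permutes_inv_inv)
    show "(\<lambda>(s, \<pi>). inv s) ` plane_perms_with_diagonal S k D
          \<subseteq> {\<theta> \<in> cyclic_orders S. int (card (cycles_on (D \<circ> \<theta>) S)) = k}"
    proof (rule image_subsetI)
      fix x assume x: "x \<in> plane_perms_with_diagonal S k D"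
      obtain s \<pi> where x_eq: "x = (s, \<pi>)" by fastforce
      have s: "s permutes S" "cyclic_on s S" and k: "int (card (cycles_on \<pi> S)) = k"
        using x by (auto simp: x_eq plane_perms_with_diagonal_def)
      have "card (cycles_on (D \<circ> inv s) S) = card (cycles_on \<pi> S)"
        using key[OF permutes_inv[OF s(1)]] pair[OF x[unfolded x_eq]]
        by (simp add: permutes_inv_inv[OF s(1)])
      thus "(case x of (s, \<pi>) \<Rightarrow> inv s)
              \<in> {\<theta> \<in> cyclic_orders S. int (card (cycles_on (D \<circ> \<theta>) S)) = k}"
        using s k D(2) by (simp add: x_eq cyclic_orders_def permutes_inv cyclic_on_inv_iff)
    qed
    show "(\<lambda>\<theta>. (inv \<theta>, inv D \<circ> inv \<theta>)) `
            {\<theta> \<in> cyclic_orders S. int (card (cycles_on (D \<circ> \<theta>) S)) = k}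
          \<subseteq> plane_perms_with_diagonal S k D"
    proof clarify
      fix \<theta> assume \<theta>': "\<theta> \<in> cyclic_orders S" and k: "k = int (card (cycles_on (D \<circ> \<theta>) S))"
      hence \<theta>: "\<theta> permutes S" "cyclic_on \<theta> S" by (auto simp: cyclic_orders_def)
      have "inv (inv D \<circ> inv \<theta>) = \<theta> \<circ> D"
        using o_inv_distrib[OF permutes_bij[OF permutes_inv[OF D(1)]]
            permutes_bij[OF permutes_inv[OF \<theta>(1)]]] D(1) \<theta>(1)
        by (simp add: permutes_inv_inv)
      hence "inv \<theta> \<circ> inv (inv D \<circ> inv \<theta>) = D"
        using \<theta>(1) by (simp add: o_assoc permutes_inv_o)
      thus "(inv \<theta>, inv D \<circ> inv \<theta>)
              \<in> plane_perms_with_diagonal S (int (card (cycles_on (D \<circ> \<theta>) S))) D"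
        using D \<theta> key[OF \<theta>(1)]
        by (simp add: plane_perms_with_diagonal_def permutes_inv permutes_compose cyclic_on_inv_iff)
    qed
  qed
qed

section \<open>Induced permutations\<close>

text \<open>
  In a permutation of a finite set every element comes back to itself, so the first return to \<open>S\<close>
  exists and the \<open>LEAST\<close> in \<open>induced_perm\<close> is attained.
\<close>

lemma induced_perm_return:
  assumes "f permutes H" "finite H" "x \<in> S"
  obtains n where "0 < n" "induced_perm f S x = (f ^^ n) x" "(f ^^ n) x \<in> S"
    "\<And>m. 0 < m \<Longrightarrow> (f ^^ m) x \<in> S \<Longrightarrow> n \<le> m"
proof -
  let ?P = "\<lambda>n. 0 < n \<and> (f ^^ n) x \<in> S"
  have "x \<in> orbit f x" using assms(1,2) by (rule self_in_orbit_permutes)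
  hence "\<exists>n. ?P n" using assms(3) by (auto simp: orbit_altdef)
  hence "?P (LEAST n. ?P n)" by (rule LeastI_ex)
  thus ?thesis
    using that[of "LEAST n. ?P n"] assms(3) Least_le[of ?P] by (simp add: induced_perm_def)
qed

text \<open>
  An element of \<open>S\<close> that \<open>f\<close> reaches after \<open>n\<close> steps is reached by the induced permutation too: the
  first return to \<open>S\<close> comes after at most \<open>n\<close> steps, and strong induction on \<open>n\<close> covers the rest.
\<close>

lemma orbit_induced_perm:
  assumes f: "f permutes H" "finite H" and x: "x \<in> S"
  shows "orbit (induced_perm f S) x = orbit f x \<inter> S"
proof (intro equalityI subsetI)
  have step: "induced_perm f S y \<in> orbit f y \<inter> S" if "y \<in> S" for y
    using induced_perm_return[OF f that] by (metis IntI funpow_in_orbit self_in_orbit_permutes[OF f])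
  fix y assume "y \<in> orbit (induced_perm f S) x"
  thus "y \<in> orbit f x \<inter> S"
    by induction (use step x in \<open>auto intro: orbit_trans\<close>)
next
  have *: "(f ^^ n) y \<in> orbit (induced_perm f S) y" if "0 < n" "y \<in> S" "(f ^^ n) y \<in> S" for n y
    using that
  proof (induction n arbitrary: y rule: less_induct)
    case (less n)
    obtain m where m: "0 < m" "induced_perm f S y = (f ^^ m) y" "(f ^^ m) y \<in> S" "m \<le> n"
      using induced_perm_return[OF f less.prems(2)] less.prems by metis
    show ?case
    proof (cases "m = n")
      case True
      thus ?thesis using m by (metis orbit.base)
    next
      case False
      have eq: "(f ^^ (n - m)) ((f ^^ m) y) = (f ^^ n) y"
        using m(4) by (simp add: funpow_add[symmetric, THEN fun_cong, unfolded o_apply])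
      have "(f ^^ (n - m)) ((f ^^ m) y) \<in> orbit (induced_perm f S) ((f ^^ m) y)"
        using False m less.prems by (intro less.IH) (auto simp: eq)
      thus ?thesis unfolding eq by (metis m(2) orbit_subset)
    qed
  qed
  fix y assume "y \<in> orbit f x \<inter> S"
  thus "y \<in> orbit (induced_perm f S) x" using * x by (auto simp: orbit_altdef)
qed

lemma induced_perm_permutes:
  assumes f: "f permutes H" "finite H" and S: "finite S"
  shows "induced_perm f S permutes S"
proof (rule bij_imp_permutes)
  have orb: "x \<in> orbit (induced_perm f S) x" if "x \<in> S" for x
    using that orbit_induced_perm[OF f that] self_in_orbit_permutes[OF f] by blast
  have mem: "induced_perm f S x \<in> S" if "x \<in> S" for x
    using orbit_induced_perm[OF f that] orbit.base[of "induced_perm f S" x] by blast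
  have "x \<in> induced_perm f S ` S" if "x \<in> S" for x
    using orb[OF that]
  proof cases
    case base
    thus ?thesis using that by blast
  next
    case (step y)
    thus ?thesis using orbit_induced_perm[OF f that] by blast
  qed
  hence "induced_perm f S ` S = S" using mem by blast
  thus "bij_betw (induced_perm f S) S S"
    using S by (simp add: bij_betw_def finite_surj_inj)
qed (simp add: induced_perm_def)

text \<open>
  Starting at \<open>x \<in> S\<close>, the first step of \<open>f \<circ> \<tau>\<close> applies \<open>\<tau>\<close> inside \<open>S\<close>; from then until the return
  to \<open>S\<close> all points lie outside \<open>S\<close>, where \<open>\<tau>\<close> is the identity. So \<open>x\<close> returns where \<open>\<tau> x\<close> does
  under \<open>f\<close>.
\<close>

lemma induced_perm_comp:
  assumes f: "f permutes H" "finite H" and \<tau>: "\<tau> permutes S"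
  shows "induced_perm (f \<circ> \<tau>) S = induced_perm f S \<circ> \<tau>"
proof
  fix x show "induced_perm (f \<circ> \<tau>) S x = (induced_perm f S \<circ> \<tau>) x"
  proof (cases "x \<in> S")
    case True
    hence \<tau>x: "\<tau> x \<in> S" using \<tau> by (simp add: permutes_in_image)
    obtain n where n: "0 < n" "induced_perm f S (\<tau> x) = (f ^^ n) (\<tau> x)" "(f ^^ n) (\<tau> x) \<in> S"
      "\<And>m. 0 < m \<Longrightarrow> (f ^^ m) (\<tau> x) \<in> S \<Longrightarrow> n \<le> m"
      using induced_perm_return[OF f \<tau>x] by metis
    have eq: "((f \<circ> \<tau>) ^^ m) x = (f ^^ m) (\<tau> x)" if "0 < m" "m \<le> n" for m
      using that
    proof (induction m)
      case (Suc m)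
      show ?case
      proof (cases "m = 0")
        case False
        hence "(f ^^ m) (\<tau> x) \<notin> S" using n(4)[of m] Suc.prems by auto
        thus ?thesis using Suc False \<tau> by (simp add: permutes_not_in)
      qed simp
    qed simp
    have "(LEAST m. 0 < m \<and> ((f \<circ> \<tau>) ^^ m) x \<in> S) = n"
    proof (rule Least_equality)
      show "0 < n \<and> ((f \<circ> \<tau>) ^^ n) x \<in> S" using n eq by simp
      show "n \<le> m" if "0 < m \<and> ((f \<circ> \<tau>) ^^ m) x \<in> S" for m
        using that n(4)[of m] eq[of m] by (cases "m \<le> n") auto
    qed
    thus ?thesis using True n eq[of n] by (simp add: induced_perm_def)
  next
    case False
    thus ?thesis using \<tau> by (simp add: induced_perm_def permutes_not_in)
  qed
qed

lemma card_cycles_meeting: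
  assumes f: "f permutes H" "finite H" and S: "S \<subseteq> H"
  shows "card {C \<in> cycles_on f H. C \<inter> S \<noteq> {}} = card (cycles_on (induced_perm f S) S)"
proof (rule bij_betw_same_card)
  have "(\<lambda>C. C \<inter> S) ` {C \<in> cycles_on f H. C \<inter> S \<noteq> {}} = cycles_on (induced_perm f S) S"
  proof (intro equalityI subsetI)
    fix A assume "A \<in> (\<lambda>C. C \<inter> S) ` {C \<in> cycles_on f H. C \<inter> S \<noteq> {}}"
    then obtain x y where "A = orbit f x \<inter> S" "y \<in> orbit f x" "y \<in> S" by (auto simp: cycles_on_def)
    thus "A \<in> cycles_on (induced_perm f S) S"
      using orbit_induced_perm[OF f, of y S] orbit_eq_of_mem[OF f, of y x]
      unfolding cycles_on_def by (metis image_eqI)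
  next
    fix A assume "A \<in> cycles_on (induced_perm f S) S"
    then obtain x where "x \<in> S" "A = orbit f x \<inter> S"
      using orbit_induced_perm[OF f] by (auto simp: cycles_on_def)
    thus "A \<in> (\<lambda>C. C \<inter> S) ` {C \<in> cycles_on f H. C \<inter> S \<noteq> {}}"
      using S self_in_orbit_permutes[OF f, of x] by (auto simp: cycles_on_def)
  qed
  moreover have "inj_on (\<lambda>C. C \<inter> S) {C \<in> cycles_on f H. C \<inter> S \<noteq> {}}"
    using disjoint_cycles_on[OF f] by (intro inj_onI) blast
  ultimately show "bij_betw (\<lambda>C. C \<inter> S) {C \<in> cycles_on f H. C \<inter> S \<noteq> {}}
      (cycles_on (induced_perm f S) S)" by (simp add: bij_betw_def)
qed

lemma cycles_avoiding_cong:
  assumes f: "f permutes H" "finite H" and g: "g permutes H"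
    and eq: "\<And>x. x \<notin> S \<Longrightarrow> f x = g x"
  shows "{C \<in> cycles_on f H. C \<inter> S = {}} = {C \<in> cycles_on g H. C \<inter> S = {}}"
proof -
  have "C \<in> cycles_on g' H"
    if "f' permutes H" "C \<in> cycles_on f' H" "C \<inter> S = {}" "\<And>x. x \<notin> S \<Longrightarrow> f' x = g' x" for C f' g'
  proof -
    obtain x where x: "x \<in> H" "C = orbit f' x" using \<open>C \<in> cycles_on f' H\<close> by (auto simp: cycles_on_def)
    have "orbit g' x = orbit f' x"
      using x that(3,4) by (intro orbit_cong self_in_orbit_permutes[OF that(1) f(2)]) (metis disjoint_iff)
    thus ?thesis using x by (auto simp: cycles_on_def)
  qed
  thus ?thesis using f g eq by (metis (mono_tags, lifting))
qed

lemma card_cycles_split: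
  assumes f: "f permutes H" "finite H" and S: "S \<subseteq> H"
  shows "card (cycles_on f H)
           = card (cycles_on (induced_perm f S) S) + card {C \<in> cycles_on f H. C \<inter> S = {}}"
proof -
  have "card (cycles_on f H)
          = card {C \<in> cycles_on f H. C \<inter> S \<noteq> {}} + card {C \<in> cycles_on f H. C \<inter> S = {}}"
    using f(2) by (subst card_Un_disjoint[symmetric]) (auto intro: arg_cong[of _ _ card])
  thus ?thesis by (simp add: card_cycles_meeting[OF assms])
qed

text \<open>
  The change in the number of cycles under a correction \<open>\<tau>\<close> supported on \<open>S\<close> is local: it equals the
  change for the induced permutations of \<open>S\<close>. The equation is written additively because of the
  subtraction of natural numbers. It is applied to the vertices (\<open>f = \<beta>\<close>) and to the faces
  (\<open>f = \<gamma>\<close>).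
\<close>

lemma card_cycles_comp:
  assumes f: "f permutes H" "finite H" and \<tau>: "\<tau> permutes S" and S: "S \<subseteq> H"
  shows "card (cycles_on (f \<circ> \<tau>) H) + card (cycles_on (induced_perm f S) S)
           = card (cycles_on f H) + card (cycles_on (induced_perm f S \<circ> \<tau>) S)"
proof -
  have "\<tau> permutes H" using \<tau> S by (rule permutes_subset)
  hence f\<tau>: "f \<circ> \<tau> permutes H" using f(1) by (rule permutes_compose)
  have "{C \<in> cycles_on (f \<circ> \<tau>) H. C \<inter> S = {}} = {C \<in> cycles_on f H. C \<inter> S = {}}"
    using f\<tau> f(2,1) by (rule cycles_avoiding_cong) (use \<tau> in \<open>simp add: permutes_not_in\<close>)
  thus ?thesis
    using card_cycles_split[OF f S] card_cycles_split[OF f\<tau> f(2) S] induced_perm_comp[OF f \<tau>] by simp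
qed

section \<open>Rearranging the half edges around a vertex\<close>

lemma induced_perm_eq_perm_restrict:
  assumes "f ` S \<subseteq> S"
  shows "induced_perm f S = perm_restrict f S"
proof
  fix x
  have "(LEAST n. 0 < n \<and> (f ^^ n) x \<in> S) = 1" if "x \<in> S"
    using that assms by (intro Least_equality) auto
  thus "induced_perm f S x = perm_restrict f S x"
    by (simp add: induced_perm_def perm_restrict_def)
qed

lemma rearrange_eq_comp:
  assumes "local_pi \<beta> v permutes v" "\<theta> permutes v"
  shows "rearrange \<beta> v \<theta> = \<beta> \<circ> (inv (local_pi \<beta> v) \<circ> \<theta>)"
proof
  fix x show "rearrange \<beta> v \<theta> x = (\<beta> \<circ> (inv (local_pi \<beta> v) \<circ> \<theta>)) x"
  proof (cases "x \<in> v")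
    case True
    hence "inv (local_pi \<beta> v) (\<theta> x) \<in> v"
      using assms by (simp add: permutes_in_image permutes_inv)
    hence "\<beta> (inv (local_pi \<beta> v) (\<theta> x)) = local_pi \<beta> v (inv (local_pi \<beta> v) (\<theta> x))"
      by (simp add: local_pi_def perm_restrict_def)
    thus ?thesis using True assms by (simp add: rearrange_def permutes_inverses)
  next
    case False
    thus ?thesis using assms(2) permutes_not_in[OF permutes_inv[OF assms(1)]]
      by (simp add: rearrange_def permutes_not_in)
  qed
qed

theorem theorem4p4:
  fixes H :: "'a set" and \<alpha> \<beta> :: "'a \<Rightarrow> 'a" and V :: "'a set set" and v :: "'a set"
    and q :: nat and \<Delta>g :: int
  assumes "embedding_of H \<alpha> V \<beta>"
    and "v \<in> V"
    and "card (incident_faces H \<alpha> \<beta> v) = q"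
  shows "rearrangement_count H \<alpha> \<beta> v \<Delta>g
           = p_num (cycle_type (diagonal \<alpha> \<beta> v) v) (int q - 2 * \<Delta>g) (card v)"
proof -
  have H: "finite H" and \<alpha>: "\<alpha> permutes H" and \<beta>: "\<beta> permutes H" and V: "cycles_on \<beta> H = V"
    using assms(1) by (auto simp: embedding_of_def connected_graph_def)
  obtain h where h: "h \<in> H" "v = orbit \<beta> h" using assms(2) V by (auto simp: cycles_on_def)
  have cyc: "cyclic_on \<beta> v" unfolding h(2) using \<beta> H by (rule cyclic_on_orbit)
  have vH: "v \<subseteq> H" unfolding h(2) using \<beta> h(1) by (rule permutes_orbit_subset)
  have v: "finite v" using vH H by (rule finite_subset)
  define \<gamma> where "\<gamma> = face_perm \<alpha> \<beta>"
  have \<gamma>: "\<gamma> permutes H" unfolding \<gamma>_def face_perm_def using \<beta> \<alpha> by (rule permutes_compose)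
  define D where "D = diagonal \<alpha> \<beta> v"
  have pi: "local_pi \<beta> v = induced_perm \<beta> v"
    unfolding local_pi_def using cyclic_on_inI[OF cyc] by (subst induced_perm_eq_perm_restrict) auto
  have pi_perm: "local_pi \<beta> v permutes v" unfolding pi using \<beta> H v by (rule induced_perm_permutes)
  have pi_cyc: "cyclic_on (local_pi \<beta> v) v"
    using cyc by (simp add: local_pi_def cyclic_on_perm_restrict)
  have s: "local_s \<alpha> \<beta> v = induced_perm \<gamma> v" by (simp add: local_s_def \<gamma>_def)
  have s_perm: "induced_perm \<gamma> v permutes v" using \<gamma> H v by (rule induced_perm_permutes)
  have D_perm: "D permutes v"
    unfolding D_def diagonal_def s using permutes_inv[OF pi_perm] s_perm by (rule permutes_compose)
  have q: "card (cycles_on (induced_perm \<gamma> v) v) = q"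
    using card_cycles_meeting[OF \<gamma> H vH] assms(3) by (simp add: incident_faces_def \<gamma>_def)
  have "genus H \<alpha> (rearrange \<beta> v \<theta>) = genus H \<alpha> \<beta> + of_int \<Delta>g
          \<longleftrightarrow> int (card (cycles_on (D \<circ> \<theta>) v)) = int q - 2 * \<Delta>g" if "\<theta> \<in> cyclic_orders v" for \<theta>
  proof -
    have \<theta>: "\<theta> permutes v" "cyclic_on \<theta> v" using that by (auto simp: cyclic_orders_def)
    define \<tau> where "\<tau> = inv (local_pi \<beta> v) \<circ> \<theta>"
    have \<tau>: "\<tau> permutes v" unfolding \<tau>_def using \<theta>(1) permutes_inv[OF pi_perm] by (rule permutes_compose)
    have re: "rearrange \<beta> v \<theta> = \<beta> \<circ> \<tau>" unfolding \<tau>_def using pi_perm \<theta>(1) by (rule rearrange_eq_comp)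
    have "local_pi \<beta> v \<circ> \<tau> = \<theta>" unfolding \<tau>_def using pi_perm by (simp add: o_assoc permutes_inv_o)
    hence verts: "card (cycles_on (rearrange \<beta> v \<theta>) H) = card (cycles_on \<beta> H)"
      using card_cycles_comp[OF \<beta> H \<tau> vH] cycles_on_cyclic[OF pi_cyc] cycles_on_cyclic[OF \<theta>(2)]
      by (simp add: re flip: pi)
    have "face_perm \<alpha> (rearrange \<beta> v \<theta>) = \<gamma> \<circ> \<tau>" by (simp add: face_perm_def \<gamma>_def re o_assoc)
    moreover have "induced_perm \<gamma> v \<circ> \<tau> = D \<circ> \<theta>" by (simp add: D_def diagonal_def s \<tau>_def o_assoc)
    ultimately have "card (cycles_on (face_perm \<alpha> (rearrange \<beta> v \<theta>)) H) + q
        = card (cycles_on \<gamma> H) + card (cycles_on (D \<circ> \<theta>) v)"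
      using card_cycles_comp[OF \<gamma> H \<tau> vH] q by simp
    hence "rat_of_nat (card (cycles_on (face_perm \<alpha> (rearrange \<beta> v \<theta>)) H)) + of_nat q
        = of_nat (card (cycles_on \<gamma> H)) + of_nat (card (cycles_on (D \<circ> \<theta>) v))"
      by (metis of_nat_add)
    hence "genus H \<alpha> (rearrange \<beta> v \<theta>) = genus H \<alpha> \<beta> + of_int \<Delta>g
        \<longleftrightarrow> rat_of_nat (card (cycles_on (D \<circ> \<theta>) v)) = of_nat q - 2 * of_int \<Delta>g"
      unfolding genus_def verts \<gamma>_def[symmetric] by (simp add: field_simps) linarith
    also have "\<dots> \<longleftrightarrow> rat_of_int (int (card (cycles_on (D \<circ> \<theta>) v))) = rat_of_int (int q - 2 * \<Delta>g)"
      by simp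
    finally show ?thesis unfolding of_int_eq_iff .
  qed
  hence "rearrangement_count H \<alpha> \<beta> v \<Delta>g
      = card {\<theta> \<in> cyclic_orders v. int (card (cycles_on (D \<circ> \<theta>) v)) = int q - 2 * \<Delta>g}"
    unfolding rearrangement_count_def by (metis (mono_tags, lifting))
  also have "\<dots> = card (plane_perms_with_diagonal v (int q - 2 * \<Delta>g) D)"
    using D_perm v by (rule card_cyclic_orders_with_product)
  also have "\<dots> = p_num (cycle_type D v) (int q - 2 * \<Delta>g) (card v)"
    using p_num_eq[OF D_perm v] by simp
  finally show ?thesis unfolding D_def .
qed

end
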